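(* Among the five theta constants $\theta[\tfrac35;\tfrac k5]$, $(k=1,3,5,7,9)$, there exist at most three which are algebraically independent over $\mathbb{C}$.
   Context: Let $\mathbb{H}^2=\{\tau\in\mathbb{C}:\Im\tau>0\}$. For $(\epsilon,\epsilon')\in\mathbb{R}^2$, $$\theta[\epsilon;\epsilon'](\zeta,\tau)=\sum_{n\in\mathbb{Z}}\exp\Big(2\pi i\Big[\tfrac12\big(n+\tfrac{\epsilon}{2}\big)^2\tau+\big(n+\tfrac{\epsilon}{2}\big)\big(\zeta+\tfrac{\epsilon'}{2}\big)\Big]\Big),$$ and the theta constant $\theta[\epsilon;\epsilon']=\theta[\epsilon;\epsilon'](0,\tau)$ is regarded as a holomorphic function of $\tau\in\mathbb{H}^2$; algebraic independence is as elements of the field of meromorphic functions on $\mathbb{H}^2$. *)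

theory Defs
  imports "HOL-Analysis.Analysis"
begin

definition theta_char :: "real \<Rightarrow> real \<Rightarrow> complex \<Rightarrow> complex \<Rightarrow> complex" where
  "theta_char e e' z \<tau> =
     (\<Sum>\<^sub>\<infinity>n::int. exp (2 * pi * \<i> *
        ((1/2) * (of_int n + of_real e / 2)^2 * \<tau>
         + (of_int n + of_real e / 2) * (z + of_real e' / 2))))"

definition theta_const :: "real \<Rightarrow> real \<Rightarrow> complex \<Rightarrow> complex" where
  "theta_const e e' \<tau> = theta_char e e' 0 \<tau>"

definition upper_half_plane :: "complex set" where
  "upper_half_plane = {\<tau>. Im \<tau> > 0}"

text \<open>A family f indexed by a finite set S of functions on U is algebraically dependent over C
  if there is a nonzero polynomial in the variables X_i (i in S) with complex coefficients
  vanishing identically on U. Polynomials are represented by a finitely supported coefficient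
  function on exponent vectors (monomials), with exponents supported in S.\<close>
definition alg_dependent_on ::
    "('i \<Rightarrow> complex \<Rightarrow> complex) \<Rightarrow> 'i set \<Rightarrow> complex set \<Rightarrow> bool" where
  "alg_dependent_on f S U \<longleftrightarrow>
     (\<exists>c :: ('i \<Rightarrow> nat) \<Rightarrow> complex.
        finite {\<alpha>. c \<alpha> \<noteq> 0} \<and> {\<alpha>. c \<alpha> \<noteq> 0} \<noteq> {} \<and>
        (\<forall>\<alpha>. c \<alpha> \<noteq> 0 \<longrightarrow> (\<forall>i. i \<notin> S \<longrightarrow> \<alpha> i = 0)) \<and>
        (\<forall>\<tau>\<in>U. (\<Sum>\<alpha>\<in>{\<alpha>. c \<alpha> \<noteq> 0}. c \<alpha> * (\<Prod>i\<in>S. f i \<tau> ^ \<alpha> i)) = 0))"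

definition alg_independent_on ::
    "('i \<Rightarrow> complex \<Rightarrow> complex) \<Rightarrow> 'i set \<Rightarrow> complex set \<Rightarrow> bool" where
  "alg_independent_on f S U \<longleftrightarrow> \<not> alg_dependent_on f S U"

end

theory Submission
  imports Defs "HOL-Complex_Analysis.Complex_Analysis"
begin

text \<open>Write T z for the odd theta function with characteristic [1; 1]. Reindexing the double series gives
  T (x + y) T (x - y) = A x B y - B x A y, so the Pluecker relation for 2 by 2 minors yields Weierstrass'
  three-term relation. Up to constants and one common factor depending only on the modulus, the five theta constants
  are the numbers X j = (-1)^j T (v + j / 5), which are 5-periodic in j. Putting a = T (2 / 5), b = T (1 / 5),
  the three-term relation becomes
  a b (X j)^2 = a^2 X (j + 1) X (j - 1) - b^2 X (j + 2) X (j - 2).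
  From three of these relations one can eliminate both X 0 and the ratio a : b, leaving a nonzero
  form of degree 15 in the other four; by periodicity any one of the five can play the role of X 0.
  The elimination needs a and b to be nonzero, which is clear near the cusp, and the
  identity theorem extends the result to the whole half-plane.\<close>

section \<open>Convergence and holomorphy of the theta series\<close>

lemma summable_on_int_exp: "(\<lambda>n::int. exp (- \<bar>real_of_int n\<bar>)) summable_on UNIV"
proof -
  have geo: "(\<lambda>n::nat. exp (- real n)) summable_on UNIV"
  proof -
    have "summable (\<lambda>n::nat. exp (- 1 :: real) ^ n)"
      by (rule summable_geometric) simp
    then have "summable (\<lambda>n::nat. exp (- real n))"
      by (simp flip: exp_of_nat_mult)
    then show ?thesis
      by (intro norm_summable_imp_summable_on) simp
  qed
  have "(\<lambda>n::int. exp (- \<bar>real_of_int n\<bar>)) summable_on (int ` UNIV)"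
    by (subst summable_on_reindex) (use geo in \<open>auto simp: o_def\<close>)
  moreover have "(\<lambda>n::int. exp (- \<bar>real_of_int n\<bar>)) summable_on ((\<lambda>n. - int n) ` UNIV)"
    by (subst summable_on_reindex) (use geo in \<open>auto simp: o_def inj_on_def\<close>)
  moreover have "UNIV = int ` UNIV \<union> (\<lambda>n. - int n) ` UNIV"
    by (auto simp: image_iff) (metis int_cases2)
  ultimately show ?thesis
    by (metis summable_on_union)
qed

text \<open>The summation variable is a real number, so a characteristic enters only as a shift of
  \<open>r\<close> by e/2 and of \<open>z\<close> by e'/2, and one general term serves every theta
  function below.\<close>

definition theta_term :: "complex \<Rightarrow> complex \<Rightarrow> real \<Rightarrow> complex" where
  "theta_term \<tau> z r = exp (2 * pi * \<i> * ((1/2) * (of_real r)\<^sup>2 * \<tau> + of_real r * z))"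

lemma norm_theta_term:
  "norm (theta_term \<tau> z r) = exp (- pi * r\<^sup>2 * Im \<tau> - 2 * pi * r * Im z)"
  by (simp add: theta_term_def power2_eq_square algebra_simps)

lemma theta_char_eq:
  "theta_char e e' z \<tau> = (\<Sum>\<^sub>\<infinity>n::int. theta_term \<tau> (z + e' / 2) (of_int n + e / 2))"
  by (simp add: theta_char_def theta_term_def)

text \<open>Completing the square shows that the quadratic part of the exponent beats the linear
  one. Since \<open>K\<close> is independent of \<open>\<tau>\<close>, the bound gives both absolute
  summability and locally uniform convergence.\<close>

lemma theta_term_bound:
  assumes "y > 0"
  obtains K where
    "\<And>\<tau> n. Im \<tau> \<ge> y \<Longrightarrow> norm (theta_term \<tau> z (of_int n + a)) \<le> K * exp (- \<bar>real_of_int n\<bar>)"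
proof
  \<comment> \<open>This is the linear coefficient of the exponent in the absolute value of
    \<open>r\<close>, plus 1. The extra 1 pays for the exponential decay in \<open>r\<close>;
    passing from \<open>r\<close> to \<open>n\<close> costs the factor with exponent
    \<open>\<bar>a\<bar>\<close> in \<open>K\<close>.\<close>
  define c where "c = 2 * pi * \<bar>Im z\<bar> + 1"
  define K where "K = exp (c\<^sup>2 / (4 * pi * y) + \<bar>a\<bar>)"
  fix \<tau> n
  assume \<tau>: "Im \<tau> \<ge> y"
  define r where "r = of_int n + a"
  have "pi * r\<^sup>2 * y \<le> pi * r\<^sup>2 * Im \<tau>"
    using \<tau> by (intro mult_left_mono) auto
  moreover have "- (2 * pi * r * Im z) \<le> 2 * pi * \<bar>r\<bar> * \<bar>Im z\<bar>"
    using abs_ge_minus_self [of "2 * pi * r * Im z"] by (simp add: abs_mult)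
  moreover have "\<bar>real_of_int n\<bar> \<le> \<bar>r\<bar> + \<bar>a\<bar>"
    by (simp add: r_def)
  moreover have "c * s - pi * s\<^sup>2 * y \<le> c\<^sup>2 / (4 * pi * y)" for s
  proof -
    have "0 \<le> (2 * pi * y * s - c)\<^sup>2"
      by simp
    then show ?thesis
      using assms by (simp add: field_simps power2_eq_square)
  qed
  from this [of "\<bar>r\<bar>"] have "c * \<bar>r\<bar> - pi * r\<^sup>2 * y \<le> c\<^sup>2 / (4 * pi * y)"
    unfolding power2_abs .
  moreover have "c * \<bar>r\<bar> = 2 * pi * \<bar>r\<bar> * \<bar>Im z\<bar> + \<bar>r\<bar>"
    by (simp add: c_def distrib_right)
  ultimately have "- pi * r\<^sup>2 * Im \<tau> - 2 * pi * r * Im z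
      \<le> (c\<^sup>2 / (4 * pi * y) + \<bar>a\<bar>) - \<bar>real_of_int n\<bar>"
    unfolding minus_mult_left [symmetric] by linarith
  then show "norm (theta_term \<tau> z (of_int n + a)) \<le> K * exp (- \<bar>real_of_int n\<bar>)"
    unfolding norm_theta_term r_def [symmetric] K_def by (simp flip: exp_add)
qed

lemma abs_summable_theta_term:
  assumes "Im \<tau> > 0"
  shows "(\<lambda>n::int. norm (theta_term \<tau> z (of_int n + a))) summable_on UNIV"
proof -
  obtain K where K: "\<And>\<tau>' n. Im \<tau>' \<ge> Im \<tau> \<Longrightarrow>
      norm (theta_term \<tau>' z (of_int n + a)) \<le> K * exp (- \<bar>real_of_int n\<bar>)"
    by (rule theta_term_bound [OF assms, of z a]) blast
  show ?thesis
    by (rule Infinite_Sum.abs_summable_on_comparison_test' [OF summable_on_cmult_right [OF summable_on_int_exp]])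
       (rule K, simp)
qed

text \<open>The disc about \<open>t\<close> of radius \<open>Im t / 2\<close> stays in the region
  \<open>Im \<tau> \<ge> Im t / 2\<close>, where the M-test makes the partial sums converge
  uniformly.\<close>

lemma holomorphic_theta_char: "theta_char e e' z holomorphic_on {\<tau>. Im \<tau> > 0}"
proof (rule holomorphic_onI)
  let ?f = "\<lambda>(n::int) \<tau>. theta_term \<tau> (z + e' / 2) (of_int n + e / 2)"
  fix t :: complex
  assume "t \<in> {\<tau>. Im \<tau> > 0}"
  then have t: "Im t / 2 > 0"
    by simp
  obtain K where K: "\<And>\<tau> n. Im \<tau> \<ge> Im t / 2 \<Longrightarrow>
      norm (?f n \<tau>) \<le> K * exp (- \<bar>real_of_int n\<bar>)"
    by (rule theta_term_bound [OF t, of "z + e' / 2" "e / 2"]) blast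
  have le: "Im \<tau> \<ge> Im t / 2" if "\<tau> \<in> cball t (Im t / 2)" for \<tau>
    using that abs_Im_le_cmod [of "t - \<tau>"] by (simp add: dist_norm)
  have "uniform_limit (cball t (Im t / 2)) (\<lambda>X \<tau>. \<Sum>n\<in>X. ?f n \<tau>) (\<lambda>\<tau>. \<Sum>\<^sub>\<infinity>n. ?f n \<tau>)
      (finite_subsets_at_top UNIV)"
    by (rule Weierstrass_m_test_general [OF _ summable_on_cmult_right [OF summable_on_int_exp]])
       (use K le in auto)
  then have "uniform_limit (cball t (Im t / 2)) (\<lambda>X \<tau>. \<Sum>n\<in>X. ?f n \<tau>) (theta_char e e' z)
      (finite_subsets_at_top UNIV)"
    by (simp add: theta_char_eq [abs_def])
  moreover have "continuous_on A (\<lambda>\<tau>. \<Sum>n\<in>X. ?f n \<tau>)"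
    and "(\<lambda>\<tau>. \<Sum>n\<in>X. ?f n \<tau>) holomorphic_on A" for X A
    by (simp_all only: theta_term_def) (intro continuous_intros holomorphic_intros)+
  ultimately obtain "theta_char e e' z holomorphic_on ball t (Im t / 2)"
    using holomorphic_uniform_limit [where z = t and r = "Im t / 2"
        and f = "\<lambda>X \<tau>. \<Sum>n\<in>X. ?f n \<tau>" and F = "finite_subsets_at_top UNIV"
        and g = "theta_char e e' z"]
    by (metis (no_types, lifting) always_eventually finite_subsets_at_top_neq_bot)
  then have "theta_char e e' z field_differentiable at t"
    by (rule holomorphic_on_imp_differentiable_at) (use t in simp_all)
  then show "theta_char e e' z field_differentiable at t within {\<tau>. Im \<tau> > 0}"
    by (rule field_differentiable_at_within)
qed

section \<open>Product formula, symmetries and the three-term relation\<close>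

text \<open>Turning a sign into a phase reduces each termwise identity below to a comparison of
  exponents modulo 2 pi i, as in \<open>exp_eq\<close>.\<close>

lemma uminus_exp_eq: "- exp u = exp (u + pi * \<i>)" for u :: complex
  by (simp add: exp_add)

lemma infsum_theta_term_product:
  assumes "Im \<tau> > 0"
  shows "(\<lambda>(m, n). theta_term \<tau> z (of_int m + a) * theta_term \<tau> w (of_int n + b))
           summable_on (UNIV :: (int \<times> int) set)" (is "?f summable_on _")
    and "(\<Sum>\<^sub>\<infinity>(m, n). theta_term \<tau> z (of_int m + a) * theta_term \<tau> w (of_int n + b)) =
           (\<Sum>\<^sub>\<infinity>m::int. theta_term \<tau> z (of_int m + a)) * (\<Sum>\<^sub>\<infinity>n::int. theta_term \<tau> w (of_int n + b))"
proof -
  note summ = abs_summable_theta_term [OF assms]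
  have "(\<lambda>x. norm (?f x)) summable_on (SIGMA m:UNIV. UNIV)"
    by (subst Infinite_Sum.abs_summable_on_Sigma_iff)
       (auto simp: norm_mult infsum_cmult_right' abs_mult
             intro!: summable_on_cmult_right summable_on_cmult_left summ
               summable_on_iff_abs_summable_on_real [THEN iffD1])
  then have *: "?f summable_on (SIGMA m:UNIV. UNIV)"
    by (rule Infinite_Sum.abs_summable_summable)
  then show "?f summable_on UNIV"
    by simp
  show "infsum ?f UNIV =
      (\<Sum>\<^sub>\<infinity>m::int. theta_term \<tau> z (of_int m + a)) * (\<Sum>\<^sub>\<infinity>n::int. theta_term \<tau> w (of_int n + b))"
    using infsum_Sigma'_banach [OF *]
    by (simp add: infsum_cmult_right' infsum_cmult_left')
qed

text \<open>For M = m + 1/2 and N = n + 1/2, put P = (M + N)/2 and Q = (M - N)/2. Then (M^2 + N^2)/2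
  = P^2 + Q^2, which doubles the modulus and separates \<open>x\<close> from \<open>y\<close>. If m
  + n is odd, P is an integer and Q a half-integer; if it is even, the roles are exchanged. The
  halves in the characteristics contribute exp(2 pi i P), hence the minus sign of the second
  product.\<close>

lemma theta_char_product:
  assumes "Im \<tau> > 0"
  shows "theta_char 1 1 (x + y) \<tau> * theta_char 1 1 (x - y) \<tau> =
     theta_char 0 0 (2 * x) (2 * \<tau>) * theta_char 1 0 (2 * y) (2 * \<tau>) -
     theta_char 1 0 (2 * x) (2 * \<tau>) * theta_char 0 0 (2 * y) (2 * \<tau>)"
proof -
  define f where "f = (\<lambda>(m::int, n::int). theta_term \<tau> (x + y + 1 / 2) (of_int m + 1 / 2) *
    theta_term \<tau> (x - y + 1 / 2) (of_int n + 1 / 2))"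
  define E where "E = {(m::int, n::int). odd (m + n)}"
  define g where "g = (\<lambda>(p::int, q::int). theta_term (2 * \<tau>) (2 * x) (of_int p + 0) *
    theta_term (2 * \<tau>) (2 * y) (of_int q + 1 / 2))"
  define h where "h = (\<lambda>(p::int, q::int). theta_term (2 * \<tau>) (2 * x) (of_int p + 1 / 2) *
    theta_term (2 * \<tau>) (2 * y) (of_int q + 0))"
  have \<tau>2: "Im (2 * \<tau>) > 0"
    using assms by simp
  have summ: "f summable_on UNIV"
    unfolding f_def by (rule infsum_theta_term_product [OF assms])
  have one: "infsum f E = infsum g UNIV"
  proof (rule sym, rule infsum_reindex_bij_witness [where j = "\<lambda>(p, q). (p + q, p - q - 1)"
      and i = "\<lambda>(m, n). ((m + n + 1) div 2, (m - n - 1) div 2)"])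
    fix pq :: "int \<times> int"
    obtain p q where pq: "pq = (p, q)"
      by fastforce
    show "f (case pq of (p, q) \<Rightarrow> (p + q, p - q - 1)) = g pq"
      unfolding pq f_def g_def theta_term_def prod.case exp_add [symmetric]
      \<comment> \<open>Here P = p, and exp(2 pi i P) shifts the exponent by exactly 2 pi i p. In
        the even case P = p + 1/2, and the remaining pi i is the sign.\<close>
      by (rule exp_eq [THEN iffD2], rule exI [of _ "p"])
         (simp add: field_simps power2_eq_square)
  next
    fix mn :: "int \<times> int"
    assume "mn \<in> E"
    then obtain m n where mn: "mn = (m, n)" "odd (m + n)"
      by (auto simp: E_def)
    obtain k where "m + n = 2 * k + 1"
      using mn(2) by (rule oddE)
    then have n: "n = 2 * k + 1 - m"
      by simp
    have div: "(m + n + 1) div 2 = k + 1" "(m - n - 1) div 2 = m - k - 1"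
      unfolding n by simp_all
    show "(case case mn of (m, n) \<Rightarrow> ((m + n + 1) div 2, (m - n - 1) div 2) of
        (p, q) \<Rightarrow> (p + q, p - q - 1)) = mn"
      by (simp only: mn(1) prod.case div) (simp add: n)
  qed (auto simp: E_def)
  have two: "infsum f (- E) = infsum (\<lambda>x. - h x) UNIV"
  proof (rule sym, rule infsum_reindex_bij_witness [where j = "\<lambda>(p, q). (p + q, p - q)"
      and i = "\<lambda>(m, n). ((m + n) div 2, (m - n) div 2)"])
    fix pq :: "int \<times> int"
    obtain p q where pq: "pq = (p, q)"
      by fastforce
    show "f (case pq of (p, q) \<Rightarrow> (p + q, p - q)) = - h pq"
      unfolding pq f_def h_def theta_term_def prod.case exp_add [symmetric] uminus_exp_eq
      by (rule exp_eq [THEN iffD2], rule exI [of _ "p"])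
         (simp add: field_simps power2_eq_square)
  next
    fix mn :: "int \<times> int"
    assume "mn \<in> - E"
    then obtain m n where mn: "mn = (m, n)" "even (m + n)"
      by (auto simp: E_def)
    obtain k where "m + n = 2 * k"
      using mn(2) by (rule evenE)
    then have n: "n = 2 * k - m"
      by simp
    have div: "(m + n) div 2 = k" "(m - n) div 2 = m - k"
      unfolding n by simp_all
    show "(case case mn of (m, n) \<Rightarrow> ((m + n) div 2, (m - n) div 2) of
        (p, q) \<Rightarrow> (p + q, p - q)) = mn"
      by (simp only: mn(1) prod.case div) (simp add: n)
  qed (auto simp: E_def)
  have "theta_char 1 1 (x + y) \<tau> * theta_char 1 1 (x - y) \<tau> = infsum f UNIV"
    unfolding f_def infsum_theta_term_product(2) [OF assms] theta_char_eq by simp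
  also have "\<dots> = infsum f (E \<union> - E)"
    by simp
  also have "\<dots> = infsum f E + infsum f (- E)"
    by (intro infsum_Un_disjoint summable_on_subset_banach [OF summ]) auto
  also have "\<dots> = infsum g UNIV - infsum h UNIV"
    by (simp add: one two infsum_uminus)
  also have "infsum g UNIV = theta_char 0 0 (2 * x) (2 * \<tau>) * theta_char 1 0 (2 * y) (2 * \<tau>)"
    unfolding g_def infsum_theta_term_product(2) [OF \<tau>2] theta_char_eq by simp
  also have "infsum h UNIV = theta_char 1 0 (2 * x) (2 * \<tau>) * theta_char 0 0 (2 * y) (2 * \<tau>)"
    unfolding h_def infsum_theta_term_product(2) [OF \<tau>2] theta_char_eq by simp
  finally show ?thesis .
qed

text \<open>The substitution n -> -n - 1 negates n + 1/2, and the second characteristic then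
  contributes exp(2 pi i (n + 1/2)) = -1.\<close>

lemma theta_char_1_1_uminus: "theta_char 1 1 (- z) \<tau> = - theta_char 1 1 z \<tau>"
proof -
  have "(\<Sum>\<^sub>\<infinity>n::int. theta_term \<tau> (- z + 1 / 2) (of_int n + 1 / 2)) =
      (\<Sum>\<^sub>\<infinity>n::int. - theta_term \<tau> (z + 1 / 2) (of_int n + 1 / 2))"
  proof (rule infsum_reindex_bij_witness [where i = "\<lambda>n. - n - 1" and j = "\<lambda>n. - n - 1"])
    fix n :: int
    show "- theta_term \<tau> (z + 1 / 2) (of_int (- n - 1) + 1 / 2) =
        theta_term \<tau> (- z + 1 / 2) (of_int n + 1 / 2)"
      unfolding theta_term_def uminus_exp_eq
      by (rule exp_eq [THEN iffD2], rule exI [of _ "- n"])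
         (simp add: field_simps power2_eq_square)
  qed auto
  then show ?thesis
    unfolding theta_char_eq by (simp add: infsum_uminus)
qed

lemma theta_char_1_1_add_1: "theta_char 1 1 (z + 1) \<tau> = - theta_char 1 1 z \<tau>"
proof -
  have "theta_term \<tau> (z + 1 + 1 / 2) (of_int n + 1 / 2) =
      - theta_term \<tau> (z + 1 / 2) (of_int n + 1 / 2)" for n :: int
    unfolding theta_term_def uminus_exp_eq
    by (rule exp_eq [THEN iffD2], rule exI [of _ n])
       (simp add: field_simps power2_eq_square)
  then show ?thesis
    unfolding theta_char_eq by (simp add: infsum_uminus)
qed

lemma theta_char_quadratic_relation:
  fixes v \<tau> :: complex
  assumes "Im \<tau> > 0"
  defines "T \<equiv> \<lambda>z. theta_char 1 1 z \<tau>"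
  shows "T (2 / 5) * T (1 / 5) * (T v)\<^sup>2 =
    (T (2 / 5))\<^sup>2 * T (v + 1 / 5) * T (v - 1 / 5) - (T (1 / 5))\<^sup>2 * T (v + 2 / 5) * T (v - 2 / 5)"
proof -
  have prod: "T (x + y) * T (x - y) =
     theta_char 0 0 (2 * x) (2 * \<tau>) * theta_char 1 0 (2 * y) (2 * \<tau>) -
     theta_char 1 0 (2 * x) (2 * \<tau>) * theta_char 0 0 (2 * y) (2 * \<tau>)" for x y
    unfolding T_def by (rule theta_char_product [OF assms(1)])
  have odd: "T (- z) = - T z" and shift: "T (z + 1) = - T z" for z
    by (simp_all add: T_def theta_char_1_1_uminus theta_char_1_1_add_1)
  \<comment> \<open>Oddness and antiperiodicity give T (1 - z) = T z, so only the constants T (1 /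
    5) and T (2 / 5) remain.\<close>
  have "T (3 / 5) = T (2 / 5)"
    using shift [of "- 2 / 5"] odd [of "2 / 5"] by simp
  \<comment> \<open>The Pluecker relation for the four arguments v, 0, 1/5, 2/5. The zeros are
    written out so that every product matches \<open>prod\<close>.\<close>
  moreover have "T (v + 0) * T (v - 0) * (T (1 / 5 + 2 / 5) * T (1 / 5 - 2 / 5)) -
      T (v + 1 / 5) * T (v - 1 / 5) * (T (0 + 2 / 5) * T (0 - 2 / 5)) +
      T (v + 2 / 5) * T (v - 2 / 5) * (T (0 + 1 / 5) * T (0 - 1 / 5)) = 0"
    unfolding prod by algebra
  ultimately show ?thesis
    using odd [of "1 / 5"] odd [of "2 / 5"] by (simp add: power2_eq_square algebra_simps)
qed

section \<open>Polynomial functions and algebraic dependence\<close>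

text \<open>Closure rules let an explicit formula be recognised as a polynomial without expanding it
  into monomials; the coefficient form is recovered afterwards.\<close>

inductive polynomial_fun :: "'i set \<Rightarrow> (('i \<Rightarrow> complex) \<Rightarrow> complex) \<Rightarrow> bool" for S where
  const: "polynomial_fun S (\<lambda>x. k)"
| var: "i \<in> S \<Longrightarrow> polynomial_fun S (\<lambda>x. x i)"
| add: "polynomial_fun S p \<Longrightarrow> polynomial_fun S q \<Longrightarrow> polynomial_fun S (\<lambda>x. p x + q x)"
| mult: "polynomial_fun S p \<Longrightarrow> polynomial_fun S q \<Longrightarrow> polynomial_fun S (\<lambda>x. p x * q x)"

lemma polynomial_fun_diff:
  assumes "polynomial_fun S p" "polynomial_fun S q"
  shows "polynomial_fun S (\<lambda>x. p x - q x)"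
  using polynomial_fun.add [OF assms(1) polynomial_fun.mult [OF polynomial_fun.const [of S "- 1"] assms(2)]]
  by simp

lemma polynomial_fun_power: "polynomial_fun S p \<Longrightarrow> polynomial_fun S (\<lambda>x. p x ^ n)"
  by (induction n) (auto intro: polynomial_fun.intros)

lemma polynomial_fun_monomials:
  assumes "finite S" "polynomial_fun S p"
  shows "\<exists>A c. finite A \<and> (\<forall>\<alpha>\<in>A. \<forall>i. i \<notin> S \<longrightarrow> \<alpha> i = 0) \<and>
    (\<forall>x. p x = (\<Sum>\<alpha>\<in>A. c \<alpha> * (\<Prod>i\<in>S. x i ^ \<alpha> i)))"
  using assms(2)
proof induction
  case (const k)
  show ?case
    by (rule exI [of _ "{\<lambda>_. 0}"], rule exI [of _ "\<lambda>_. k"]) simp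
next
  case (var i)
  have "(\<Prod>j\<in>S. x j ^ (if j = i then 1 else 0)) = x i" for x :: "_ \<Rightarrow> complex"
    using assms(1) var by (simp add: if_distrib [of "power _"] prod.delta cong: if_cong)
  then show ?case
    using var by (intro exI [of _ "{\<lambda>j. if j = i then 1 else 0}"] exI [of _ "\<lambda>_. 1"]) auto
next
  case (add p q)
  from add.IH(1) obtain A c where A: "finite A" "\<forall>\<alpha>\<in>A. \<forall>i. i \<notin> S \<longrightarrow> \<alpha> i = 0"
      "\<forall>x. p x = (\<Sum>\<alpha>\<in>A. c \<alpha> * (\<Prod>i\<in>S. x i ^ \<alpha> i))"
    by blast
  from add.IH(2) obtain B d where B: "finite B" "\<forall>\<alpha>\<in>B. \<forall>i. i \<notin> S \<longrightarrow> \<alpha> i = 0"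
      "\<forall>x. q x = (\<Sum>\<alpha>\<in>B. d \<alpha> * (\<Prod>i\<in>S. x i ^ \<alpha> i))"
    by blast
  let ?c = "\<lambda>\<alpha>. if \<alpha> \<in> A then c \<alpha> else 0" and ?d = "\<lambda>\<alpha>. if \<alpha> \<in> B then d \<alpha> else 0"
  have "p x = (\<Sum>\<alpha>\<in>A \<union> B. ?c \<alpha> * (\<Prod>i\<in>S. x i ^ \<alpha> i))" for x
    unfolding A(3) [rule_format] using A(1) B(1) by (intro sum.mono_neutral_cong_left) auto
  moreover have "q x = (\<Sum>\<alpha>\<in>A \<union> B. ?d \<alpha> * (\<Prod>i\<in>S. x i ^ \<alpha> i))" for x
    unfolding B(3) [rule_format] using A(1) B(1) by (intro sum.mono_neutral_cong_left) auto
  ultimately have "p x + q x = (\<Sum>\<alpha>\<in>A \<union> B. (?c \<alpha> + ?d \<alpha>) * (\<Prod>i\<in>S. x i ^ \<alpha> i))" for x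
    by (simp only: distrib_right sum.distrib)
  then show ?case
    using A B by (intro exI [of _ "A \<union> B"] exI [of _ "\<lambda>\<alpha>. ?c \<alpha> + ?d \<alpha>"]) auto
next
  case (mult p q)
  from mult.IH(1) obtain A c where A: "finite A" "\<forall>\<alpha>\<in>A. \<forall>i. i \<notin> S \<longrightarrow> \<alpha> i = 0"
      "\<forall>x. p x = (\<Sum>\<alpha>\<in>A. c \<alpha> * (\<Prod>i\<in>S. x i ^ \<alpha> i))"
    by blast
  from mult.IH(2) obtain B d where B: "finite B" "\<forall>\<alpha>\<in>B. \<forall>i. i \<notin> S \<longrightarrow> \<alpha> i = 0"
      "\<forall>x. q x = (\<Sum>\<alpha>\<in>B. d \<alpha> * (\<Prod>i\<in>S. x i ^ \<alpha> i))"
    by blast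
  define h :: "('a \<Rightarrow> nat) \<times> ('a \<Rightarrow> nat) \<Rightarrow> 'a \<Rightarrow> nat"
    where "h = (\<lambda>(\<alpha>, \<beta>) i. \<alpha> i + \<beta> i)"
  \<comment> \<open>Different pairs of exponent vectors may have the same sum, so the coefficients
    of the product are collected along the fibres of \<open>h\<close>.\<close>
  define e where "e = (\<lambda>\<gamma>. \<Sum>(\<alpha>, \<beta>) | \<alpha> \<in> A \<and> \<beta> \<in> B \<and> h (\<alpha>, \<beta>) = \<gamma>. c \<alpha> * d \<beta>)"
  have "p x * q x = (\<Sum>\<gamma>\<in>h ` (A \<times> B). e \<gamma> * (\<Prod>i\<in>S. x i ^ \<gamma> i))" for x
  proof -
    have "p x * q x = (\<Sum>(\<alpha>, \<beta>)\<in>A \<times> B. c \<alpha> * d \<beta> * (\<Prod>i\<in>S. x i ^ h (\<alpha>, \<beta>) i))"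
      unfolding A(3) [rule_format] B(3) [rule_format] sum_product sum.cartesian_product
      by (intro sum.cong) (auto simp: h_def power_add prod.distrib)
    also have "\<dots> = (\<Sum>\<gamma>\<in>h ` (A \<times> B). \<Sum>(\<alpha>, \<beta>) | \<alpha> \<in> A \<and> \<beta> \<in> B \<and> h (\<alpha>, \<beta>) = \<gamma>.
        c \<alpha> * d \<beta> * (\<Prod>i\<in>S. x i ^ h (\<alpha>, \<beta>) i))"
      using A(1) B(1) by (subst sum.image_gen [of _ _ h]) (auto intro!: sum.cong)
    also have "\<dots> = (\<Sum>\<gamma>\<in>h ` (A \<times> B). e \<gamma> * (\<Prod>i\<in>S. x i ^ \<gamma> i))"
      unfolding e_def sum_distrib_right by (intro sum.cong) auto
    finally show ?thesis .
  qed
  moreover have "\<forall>\<gamma>\<in>h ` (A \<times> B). \<forall>i. i \<notin> S \<longrightarrow> \<gamma> i = 0"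
    using A(2) B(2) by (auto simp: h_def)
  ultimately show ?case
    using A(1) B(1) by (intro exI [of _ "h ` (A \<times> B)"] exI [of _ e]) auto
qed

text \<open>One point \<open>x\<close> with nonzero value certifies that some coefficient is
  nonzero, so the coefficients of \<open>p\<close> never have to be computed.\<close>

lemma alg_dependent_onI:
  assumes "finite S" "polynomial_fun S p" "p x \<noteq> 0"
    and zero: "\<And>\<tau>. \<tau> \<in> U \<Longrightarrow> p (\<lambda>i. f i \<tau>) = 0"
  shows "alg_dependent_on f S U"
proof -
  obtain A c where A: "finite A" "\<forall>\<alpha>\<in>A. \<forall>i. i \<notin> S \<longrightarrow> \<alpha> i = 0"
    and p: "\<forall>x. p x = (\<Sum>\<alpha>\<in>A. c \<alpha> * (\<Prod>i\<in>S. x i ^ \<alpha> i))"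
    using polynomial_fun_monomials [OF assms(1,2)] by blast
  define d where "d = (\<lambda>\<alpha>. if \<alpha> \<in> A then c \<alpha> else 0)"
  have supp: "{\<alpha>. d \<alpha> \<noteq> 0} \<subseteq> A"
    by (auto simp: d_def)
  have p': "p x = (\<Sum>\<alpha> | d \<alpha> \<noteq> 0. d \<alpha> * (\<Prod>i\<in>S. x i ^ \<alpha> i))" for x
    unfolding p [rule_format] using A(1) supp by (intro sum.mono_neutral_cong_right) (auto simp: d_def)
  moreover have "{\<alpha>. d \<alpha> \<noteq> 0} \<noteq> {}"
    using \<open>p x \<noteq> 0\<close> unfolding p' by force
  ultimately show ?thesis
    unfolding alg_dependent_on_def
    using finite_subset [OF supp A(1)] supp A(2) zero by (intro exI [of _ d]) auto
qed

section \<open>Nonvanishing near the cusp\<close>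

text \<open>The terms n = 0 and n = -1 dominate. Their sum has norm \<open>c\<close> times exp(-pi/4
  Im tau), while the remaining terms together are smaller by a factor that decays like exp(-Im
  tau).\<close>

lemma theta_char_1_1_nonzero:
  fixes x :: real
  assumes "sin (pi * x) \<noteq> 0"
  obtains Y where "\<And>\<tau>. Im \<tau> > Y \<Longrightarrow> theta_char 1 1 x \<tau> \<noteq> 0"
proof
  define c where "c = 2 * \<bar>sin (pi * x)\<bar>"
  \<comment> \<open>The norms at modulus i serve as a reference: for real \<open>x\<close> the norm
    of a term depends only on \<open>Im \<tau>\<close>, and only the excess \<open>s\<close> of
    \<open>Im \<tau>\<close> over 1 has to be estimated.\<close>
  define M where "M = (\<lambda>n::int. norm (theta_term \<i> 0 (of_int n + 1 / 2)))"
  define K where "K = exp (pi / 4) * infsum M (- {0, - 1})"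
  have "M summable_on UNIV"
    unfolding M_def by (rule abs_summable_theta_term) simp
  then have M: "M summable_on (- {0, - 1})"
    by (rule summable_on_subset_banach) simp
  have c: "c > 0"
    using assms by (simp add: c_def)
  fix \<tau>
  \<comment> \<open>The threshold ensures \<open>s * c > K\<close>, contradicting the final estimate
    \<open>c \<le> exp (- s) * K\<close> because exp s > s.\<close>
  assume \<tau>: "Im \<tau> > 1 + max 0 (K / c)"
  define s where "s = Im \<tau> - 1"
  have s: "s > 0" "s * c > K"
    using \<tau> c by (simp_all add: s_def flip: pos_divide_less_eq)
  define f where "f = (\<lambda>n::int. theta_term \<tau> (x + 1 / 2) (of_int n + 1 / 2))"
  have f: "(\<lambda>n. norm (f n)) summable_on UNIV"
    unfolding f_def by (rule abs_summable_theta_term) (use s in \<open>simp add: s_def\<close>)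
  have theta: "theta_char 1 1 x \<tau> = infsum f UNIV"
    by (simp add: theta_char_eq f_def)
  show "theta_char 1 1 x \<tau> \<noteq> 0"
  proof
    assume zero: "theta_char 1 1 x \<tau> = 0"
    have "infsum f UNIV = infsum f ({0, - 1} \<union> - {0, - 1})"
      by (simp del: Compl_insert)
    also have "\<dots> = f 0 + f (- 1) + infsum f (- {0, - 1})"
      by (subst infsum_Un_disjoint)
         (auto intro: summable_on_subset_banach [OF Infinite_Sum.abs_summable_summable [OF f]])
    finally have "norm (f 0 + f (- 1)) = norm (infsum f (- {0, - 1}))"
      using zero theta by (metis add_eq_0_iff norm_minus_cancel)
    also have "\<dots> \<le> infsum (\<lambda>n. norm (f n)) (- {0, - 1})"
      by (intro norm_infsum_bound summable_on_subset_banach [OF f]) auto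
    also have "\<dots> \<le> infsum (\<lambda>n. exp (- pi / 4 * s - s) * M n) (- {0, - 1})"
    proof (rule infsum_mono)
      show "(\<lambda>n. norm (f n)) summable_on - {0, - 1}"
        by (rule summable_on_subset_banach [OF f]) simp
      show "(\<lambda>n. exp (- pi / 4 * s - s) * M n) summable_on - {0, - 1}"
        by (intro summable_on_cmult_right M)
      fix n :: int
      assume "n \<in> - {0, - 1}"
      then have "n \<ge> 1 \<or> n \<le> - 2"
        by auto
      \<comment> \<open>Away from 0 and -1 this bounds n (n + 1) from below, so that pi (n + 1/2)^2
        exceeds pi/4 by at least 1. That gap is the source of the extra factor exp(-s).\<close>
      then have "(n - 1) * (n + 2) \<ge> 0"
        by (auto simp: zero_le_mult_iff)
      then have "real_of_int ((n - 1) * (n + 2)) \<ge> 0"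
        by (simp only: of_int_0_le_iff)
      then have "real_of_int n * (real_of_int n + 1) \<ge> 1"
        by (simp add: algebra_simps)
      then have "pi * 1 \<le> pi * (real_of_int n * (real_of_int n + 1))"
        by (intro mult_left_mono) simp_all
      then have "pi * (real_of_int n + 1 / 2)\<^sup>2 \<ge> pi / 4 + 1"
        using pi_gt3 by (simp add: power2_eq_square algebra_simps)
      then have "s * (pi * (real_of_int n + 1 / 2)\<^sup>2) \<ge> s * (pi / 4 + 1)"
        using s by (intro mult_left_mono) auto
      then have "- pi * (real_of_int n + 1 / 2)\<^sup>2 * (1 + s)
          \<le> - pi / 4 * s - s - pi * (real_of_int n + 1 / 2)\<^sup>2"
        by (simp add: algebra_simps)
      then show "norm (f n) \<le> exp (- pi / 4 * s - s) * M n"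
        unfolding f_def M_def norm_theta_term by (simp add: s_def flip: exp_add)
    qed
    also have "\<dots> = exp (- pi / 4 * Im \<tau>) * (exp (- s) * K)"
      unfolding infsum_cmult_right' K_def mult.assoc [symmetric] exp_add [symmetric]
      by (simp add: s_def field_simps)
    finally have le: "norm (f 0 + f (- 1)) \<le> exp (- pi / 4 * Im \<tau>) * (exp (- s) * K)" .
    have "f 0 = exp (pi * \<i> * \<tau> / 4) * exp (\<i> * of_real (pi * (x + 1 / 2)))"
      and "f (- 1) = exp (pi * \<i> * \<tau> / 4) * exp (- (\<i> * of_real (pi * (x + 1 / 2))))"
      unfolding f_def theta_term_def exp_add [symmetric]
      by (rule arg_cong [of _ _ exp], simp add: power2_eq_square field_simps)+
    then have "f 0 + f (- 1) = exp (pi * \<i> * \<tau> / 4) * (2 * of_real (cos (pi * (x + 1 / 2))))"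
      unfolding cos_of_real [symmetric] cos_exp_eq by (simp add: distrib_left)
    moreover have "cos (pi * (x + 1 / 2)) = - sin (pi * x)"
      by (simp add: distrib_left cos_add)
    ultimately have "norm (f 0 + f (- 1)) = exp (- pi / 4 * Im \<tau>) * c"
      by (simp add: norm_mult c_def)
    then have "c \<le> exp (- s) * K"
      using le by simp
    then have "exp s * c \<le> exp s * (exp (- s) * K)"
      by (intro mult_left_mono) simp_all
    also have "\<dots> = K"
      by (simp flip: mult.assoc exp_add)
    also have "K < s * c"
      by (rule s)
    also have "\<dots> \<le> exp s * c"
      using exp_ge_add_one_self [of s] c by (intro mult_right_mono) linarith+
    finally show False
      by simp
  qed
qed

section \<open>Elimination among the five shifted theta values\<close>

text \<open>Since 3/10 = 1/2 - 1/5, changing the first characteristic from 1 to 3/5 amounts to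
  translating the argument by -tau/5; the prefactor comes from expanding the square.\<close>

lemma theta_const_eq_theta_char_1_1:
  "theta_const (3 / 5) e' \<tau> = exp (pi * \<i> * (\<tau> / 25 - e' / 5)) * theta_char 1 1 (e' / 2 - 1 / 2 - \<tau> / 5) \<tau>"
proof -
  have "theta_term \<tau> (0 + of_real (e' / 2)) (of_int n + 3 / 5 / 2) =
      exp (pi * \<i> * (\<tau> / 25 - e' / 5)) *
      theta_term \<tau> (e' / 2 - 1 / 2 - \<tau> / 5 + of_real (1 / 2)) (of_int n + 1 / 2)" for n :: int
    unfolding theta_term_def exp_add [symmetric]
    by (rule arg_cong [of _ _ exp]) (simp add: field_simps power2_eq_square)
  then show ?thesis
    unfolding theta_const_def theta_char_eq by (simp only: infsum_cmult_right') simp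
qed

text \<open>The variables w, x, y, z stand for X 1, ..., X 4 of the header. With N and D as below, elimination of
  X 0 gives a D = b N together with the quartic form in (a, b) of \<open>elim\<close> in the proof of
  \<open>resolvent_eq_0\<close>; the resolvent is that quartic form at (a, b) = (N, D).\<close>

definition resolvent :: "complex \<Rightarrow> complex \<Rightarrow> complex \<Rightarrow> complex \<Rightarrow> complex" where
  "resolvent w x y z =
    (let N = w * x\<^sup>2 - y\<^sup>2 * z; D = w\<^sup>2 * y - x * z\<^sup>2
     in N ^ 4 * w * x * y - N ^ 3 * D * x ^ 3 - N * D ^ 3 * w\<^sup>2 * z - D ^ 4 * y * z\<^sup>2)"

text \<open>\<open>N\<close> and \<open>D\<close> are cubic, so every term has degree 15. This
  disposes of the factor common to the theta constants.\<close>

lemma resolvent_scale: "resolvent (c * w) (c * x) (c * y) (c * z) = c ^ 15 * resolvent w x y z"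
  unfolding resolvent_def Let_def by algebra

lemma resolvent_eq_0:
  assumes "a \<noteq> 0" "b \<noteq> 0"
    and 1: "a * b * w\<^sup>2 = a\<^sup>2 * x * v - b\<^sup>2 * y * z"
    and 2: "a * b * x\<^sup>2 = a\<^sup>2 * y * w - b\<^sup>2 * z * v"
    and 3: "a * b * y\<^sup>2 = a\<^sup>2 * z * x - b\<^sup>2 * v * w"
  shows "resolvent w x y z = 0"
proof -
  define N D where "N = w * x\<^sup>2 - y\<^sup>2 * z" and "D = w\<^sup>2 * y - x * z\<^sup>2"
  \<comment> \<open>\<open>w\<close> times relation \<open>2\<close> minus \<open>z\<close> times
    relation \<open>3\<close> cancels \<open>v\<close>.\<close>
  have "a * (a * D) = a * (b * N)"
    using 2 3 unfolding N_def D_def by algebra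
  then have aD: "a * D = b * N"
    using assms(1) by simp
  \<comment> \<open>Relations \<open>1\<close> and \<open>2\<close> express
    \<open>a\<^sup>2 * x * v\<close> and \<open>b\<^sup>2 * z * v\<close>; cross-multiplying removes
    \<open>v\<close>.\<close>
  have elim: "a ^ 4 * w * x * y - a ^ 3 * b * x ^ 3 - a * b ^ 3 * w\<^sup>2 * z - b ^ 4 * y * z\<^sup>2 = 0"
    using 1 2 by algebra
  \<comment> \<open>Multiplying by \<open>b ^ 4\<close> and replacing \<open>b * N\<close> by
    \<open>a * D\<close> avoids a division by \<open>D\<close>, which may vanish.\<close>
  have "b ^ 4 * resolvent w x y z =
      (b * N) ^ 4 * w * x * y - (b * N) ^ 3 * (b * D) * x ^ 3 - (b * N) * (b * D) ^ 3 * w\<^sup>2 * z -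
      (b * D) ^ 4 * y * z\<^sup>2"
    unfolding resolvent_def Let_def N_def [symmetric] D_def [symmetric] by algebra
  also have "\<dots> = D ^ 4 * (a ^ 4 * w * x * y - a ^ 3 * b * x ^ 3 - a * b ^ 3 * w\<^sup>2 * z - b ^ 4 * y * z\<^sup>2)"
    unfolding aD [symmetric] by algebra
  finally show ?thesis
    using elim assms(2) by simp
qed

text \<open>Five steps of 1/5 change the sign of the theta value, and the phase compensates. The
  relations at k + 1, k + 2, k + 3 then eliminate \<open>X k\<close>, for any
  \<open>k\<close>.\<close>

lemma resolvent_theta_char_eq_0:
  fixes \<tau> v :: complex and k :: int
  assumes "Im \<tau> > 0" "theta_char 1 1 (1 / 5) \<tau> \<noteq> 0" "theta_char 1 1 (2 / 5) \<tau> \<noteq> 0"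
  defines "X \<equiv> \<lambda>j::int. exp (pi * \<i> * j) * theta_char 1 1 (v + j / 5) \<tau>"
  shows "X (j + 5) = X j"
    and "resolvent (X (k + 1)) (X (k + 2)) (X (k + 3)) (X (k + 4)) = 0"
proof -
  have period: "X (j + 5) = X j" for j
  proof -
    have "exp (pi * \<i> * of_int (j + 5)) = - exp (pi * \<i> * of_int j)"
      using exp_plus_2pin [of "pi * \<i> * of_int j + pi * \<i>" 2] by (simp add: algebra_simps exp_add)
    moreover have "theta_char 1 1 (v + of_int (j + 5) / 5) \<tau> = - theta_char 1 1 (v + of_int j / 5) \<tau>"
      using theta_char_1_1_add_1 [of "v + of_int j / 5" \<tau>] by (simp add: add_divide_distrib add.assoc)
    ultimately show ?thesis
      by (simp add: X_def)
  qed
  then show "X (j + 5) = X j" .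
  define a b where "a = theta_char 1 1 (2 / 5) \<tau>" and "b = theta_char 1 1 (1 / 5) \<tau>"
  have rel: "a * b * (X j)\<^sup>2 = a\<^sup>2 * X (j + 1) * X (j - 1) - b\<^sup>2 * X (j + 2) * X (j - 2)" for j
  proof -
    define V e where "V = v + of_int j / 5" and "e = (\<lambda>i::int. exp (pi * \<i> * of_int (j + i)))"
    have X: "X (j + i) = e i * theta_char 1 1 (V + of_int i / 5) \<tau>" for i
      by (simp add: X_def V_def e_def add_divide_distrib add.assoc)
    \<comment> \<open>The phases of the three terms agree, so the relation for theta values passes
      to \<open>X\<close> unchanged.\<close>
    have "e i * e (- i) = (e 0)\<^sup>2" for i
      by (simp add: e_def power2_eq_square algebra_simps flip: exp_add)
    from this [of 1] this [of 2] show ?thesis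
      using theta_char_quadratic_relation [OF assms(1), of V] X [of 0] X [of 1] X [of "- 1"] X [of 2] X [of "- 2"]
      unfolding a_def [symmetric] b_def [symmetric]
      by (simp add: power_mult_distrib) algebra
  qed
  show "resolvent (X (k + 1)) (X (k + 2)) (X (k + 3)) (X (k + 4)) = 0"
  proof (rule resolvent_eq_0)
    show "a \<noteq> 0" "b \<noteq> 0"
      using assms(2,3) by (simp_all add: a_def b_def)
    have "X (k - 1) = X (k + 4)" "X (k + 5) = X k"
      using period [of "k - 1"] period [of k] by (simp_all add: add.commute)
    then show "a * b * (X (k + 1))\<^sup>2 = a\<^sup>2 * X (k + 2) * X k - b\<^sup>2 * X (k + 3) * X (k + 4)"
      and "a * b * (X (k + 2))\<^sup>2 = a\<^sup>2 * X (k + 3) * X (k + 1) - b\<^sup>2 * X (k + 4) * X k"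
      and "a * b * (X (k + 3))\<^sup>2 = a\<^sup>2 * X (k + 4) * X (k + 2) - b\<^sup>2 * X k * X (k + 1)"
      using rel [of "k + 1"] rel [of "k + 2"] rel [of "k + 3"] by (simp_all add: algebra_simps)
  qed
qed

section \<open>Transfer to the theta constants and the final count\<close>

text \<open>Cyclic positions modulo 5 correspond to the numerators 1, 3, 5, 7, 9.\<close>

definition theta_index :: "int \<Rightarrow> nat" where
  "theta_index j = nat (2 * (j mod 5) + 1)"

text \<open>The sign (-1)^j, with j reduced modulo 5, times the inverse of the constant exp(-pi i
  e'/5) in \<open>theta_const_eq_theta_char_1_1\<close>, where e' = (2 j + 1)/5.\<close>

definition theta_phase :: "int \<Rightarrow> complex" where
  "theta_phase j = exp (pi * \<i> * (of_int (j mod 5) + (2 * of_int (j mod 5) + 1) / 25))"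

definition theta_resolvent :: "int \<Rightarrow> (nat \<Rightarrow> complex) \<Rightarrow> complex" where
  "theta_resolvent k x = resolvent (theta_phase (k + 1) * x (theta_index (k + 1))) (theta_phase (k + 2) * x (theta_index (k + 2)))
     (theta_phase (k + 3) * x (theta_index (k + 3))) (theta_phase (k + 4) * x (theta_index (k + 4)))"

lemma theta_resolvent_eq_0_if_nonzero:
  assumes "Im \<tau> > 0" "theta_char 1 1 (1 / 5) \<tau> \<noteq> 0" "theta_char 1 1 (2 / 5) \<tau> \<noteq> 0"
  shows "theta_resolvent k (\<lambda>i. theta_const (3 / 5) (real i / 5) \<tau>) = 0"
proof -
  \<comment> \<open>For e' = (2 i + 1)/5 one has e'/2 - 1/2 = i/5 - 2/5.\<close>
  define v where "v = - 2 / 5 - \<tau> / 5"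
  define X where "X = (\<lambda>j::int. exp (pi * \<i> * j) * theta_char 1 1 (v + j / 5) \<tau>)"
  have period: "X (j + 5) = X j" for j
    unfolding X_def by (rule resolvent_theta_char_eq_0(1) [OF assms])
  have zero: "resolvent (X (k + 1)) (X (k + 2)) (X (k + 3)) (X (k + 4)) = 0"
    unfolding X_def by (rule resolvent_theta_char_eq_0(2) [OF assms])
  define C where "C = exp (pi * \<i> * \<tau> / 25)"
  have "X (i + 5 * n) = X i" for i n
  proof (induction n rule: int_induct [where k = 0])
    case (step1 n)
    then show ?case
      using period [of "i + 5 * n"] by (simp add: distrib_left add.assoc)
  next
    case (step2 n)
    then show ?case
      using period [of "i + 5 * (n - 1)"] by (simp add: right_diff_distrib)
  qed simp
  then have Xmod: "X (j mod 5) = X j" for j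
    using mod_mult_div_eq [of j 5] by metis
  have "theta_phase j * theta_const (3 / 5) (real (theta_index j) / 5) \<tau> = C * X j" for j
  proof -
    define i where "i = j mod 5"
    have i: "real (theta_index j) = 2 * of_int i + 1"
      by (simp add: theta_index_def i_def)
    have v: "complex_of_real (real (theta_index j) / 5) / 2 - 1 / 2 - \<tau> / 5 = v + of_int i / 5"
      unfolding i v_def by (simp add: field_simps)
    have "theta_phase j * exp (pi * \<i> * (\<tau> / 25 - complex_of_real (real (theta_index j) / 5) / 5)) =
        C * exp (pi * \<i> * of_int i)"
      unfolding i theta_phase_def C_def exp_add [symmetric] i_def [symmetric]
      by (rule arg_cong [of _ _ exp]) (simp add: field_simps)
    then show ?thesis
      unfolding Xmod [of j, symmetric] i_def [symmetric]
      unfolding X_def theta_const_eq_theta_char_1_1 v by (simp flip: mult.assoc)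
  qed
  then show ?thesis
    by (simp add: theta_resolvent_def resolvent_scale zero)
qed

lemma theta_resolvent_eq_0:
  assumes "Im \<tau> > 0"
  shows "theta_resolvent k (\<lambda>i. theta_const (3 / 5) (real i / 5) \<tau>) = 0"
proof -
  let ?F = "\<lambda>\<tau>. theta_resolvent k (\<lambda>i. theta_const (3 / 5) (real i / 5) \<tau>)"
  have "sin (pi * (1 / 5)) \<noteq> 0" "sin (pi * (2 / 5)) \<noteq> 0"
    by (auto intro!: sin_gt_zero less_imp_neq [symmetric])
  then obtain Y Z where Y: "\<And>\<tau>. Im \<tau> > Y \<Longrightarrow> theta_char 1 1 (of_real (1 / 5)) \<tau> \<noteq> 0"
    and Z: "\<And>\<tau>. Im \<tau> > Z \<Longrightarrow> theta_char 1 1 (of_real (2 / 5)) \<tau> \<noteq> 0"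
    using theta_char_1_1_nonzero by metis
  \<comment> \<open>The 0 keeps the half-plane \<open>Im \<tau> > B\<close> inside the domain of
    holomorphy.\<close>
  define B where "B = max 0 (max Y Z)"
  have hol: "(\<lambda>\<tau>. theta_const (3 / 5) (real i / 5) \<tau>) holomorphic_on {\<tau>. Im \<tau> > 0}" for i
    using holomorphic_theta_char [of "3 / 5" "real i / 5" 0] by (simp add: theta_const_def [abs_def])
  show ?thesis
  proof (rule analytic_continuation_open [where f = ?F and g = "\<lambda>_. 0"])
    show "open {\<tau>. Im \<tau> > B}" "open {\<tau>. Im \<tau> > 0}"
      by (rule open_halfspace_Im_gt)+
    show "connected {\<tau>. Im \<tau> > 0}"
      by (intro convex_connected convex_halfspace_Im_gt)
    show "?F holomorphic_on {\<tau>. Im \<tau> > 0}"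
      unfolding theta_resolvent_def resolvent_def Let_def by (intro holomorphic_intros hol)
    have "Complex 0 (B + 1) \<in> {\<tau>. Im \<tau> > B}"
      by simp
    then show "{\<tau>. Im \<tau> > B} \<noteq> {}"
      by blast
    show "?F \<tau> = 0" if "\<tau> \<in> {\<tau>. Im \<tau> > B}" for \<tau>
      using that Y [of \<tau>] Z [of \<tau>] by (intro theta_resolvent_eq_0_if_nonzero) (auto simp: B_def)
  qed (use assms in \<open>auto simp: B_def\<close>)
qed

lemma polynomial_fun_resolvent:
  assumes "polynomial_fun S p" "polynomial_fun S q" "polynomial_fun S r" "polynomial_fun S s"
  shows "polynomial_fun S (\<lambda>x. resolvent (p x) (q x) (r x) (s x))"
  unfolding resolvent_def Let_def
  by (intro polynomial_fun.mult polynomial_fun_diff polynomial_fun_power assms)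

lemma polynomial_fun_theta_resolvent:
  assumes "\<And>i. i \<in> {1..4} \<Longrightarrow> theta_index (k + i) \<in> S"
  shows "polynomial_fun S (theta_resolvent k)"
  unfolding theta_resolvent_def [abs_def]
  by (intro polynomial_fun_resolvent polynomial_fun.mult polynomial_fun.const polynomial_fun.var assms)
     simp_all

lemma theta_resolvent_nonzero: "\<exists>x. theta_resolvent k x \<noteq> 0"
proof -
  \<comment> \<open>The test point is (1, 1, 1, 2), where N = -1, D = -3 and the resolvent is -380.
    At (1, 1, 1, 1) both \<open>N\<close> and \<open>D\<close> vanish, so one entry must
    differ.\<close>
  define w :: "int \<Rightarrow> complex" where "w = (\<lambda>i. if i mod 5 = (k + 4) mod 5 then 2 else 1)"
  \<comment> \<open>Halving the odd index \<open>n\<close> recovers the position modulo 5; the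
    division cancels the phase.\<close>
  define x where "x = (\<lambda>n. w (int (n div 2)) / theta_phase (int (n div 2)))"
  have "theta_phase j * x (theta_index j) = w j" for j
  proof -
    have "int (theta_index j div 2) = j mod 5"
      by (simp add: theta_index_def nat_div_distrib zdiv_int)
    moreover have "theta_phase (j mod 5) = theta_phase j" "theta_phase j \<noteq> 0" "w (j mod 5) = w j"
      by (simp_all add: theta_phase_def w_def)
    ultimately show ?thesis
      by (simp add: x_def)
  qed
  moreover have "w (k + 1) = 1" "w (k + 2) = 1" "w (k + 3) = 1" "w (k + 4) = 2"
    by (simp_all add: w_def mod_eq_dvd_iff)
  ultimately have "theta_resolvent k x \<noteq> 0"
    by (simp add: theta_resolvent_def resolvent_def)
  then show ?thesis
    by (rule exI [of _ x])
qed

theorem theorem7p3: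
  shows "\<forall>S \<subseteq> {1, 3, 5, 7, 9 :: nat}.
           alg_independent_on (\<lambda>k. theta_const (3/5) (real k / 5)) S upper_half_plane
             \<longrightarrow> card S \<le> 3"
proof (intro allI impI)
  fix S :: "nat set"
  assume S: "S \<subseteq> {1, 3, 5, 7, 9}"
    and indep: "alg_independent_on (\<lambda>k. theta_const (3/5) (real k / 5)) S upper_half_plane"
  show "card S \<le> 3"
  proof (rule ccontr)
    assume "\<not> card S \<le> 3"
    moreover have "card ({1, 3, 5, 7, 9} - S) = 5 - card S"
      using S by (subst card_Diff_subset) (auto intro: finite_subset)
    ultimately have "card ({1, 3, 5, 7, 9} - S) \<le> Suc 0"
      by simp
    then have unique: "\<forall>m\<in>{1, 3, 5, 7, 9} - S. \<forall>n\<in>{1, 3, 5, 7, 9} - S. m = n"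
      by (simp only: card_le_Suc0_iff_eq finite_Diff finite_insert finite.emptyI)
    obtain n where n: "n \<in> {1, 3, 5, 7, 9}" "{1, 3, 5, 7, 9} - S \<subseteq> {n}"
    proof (cases "{1, 3, 5, 7, 9} \<subseteq> S")
      \<comment> \<open>With all five present, any one may be left out; 1 is an arbitrary
        choice.\<close>
      case True
      then show ?thesis
        by (intro that [of 1]) auto
    next
      case False
      then obtain n where "n \<in> {1, 3, 5, 7, 9} - S"
        by blast
      then show ?thesis
        using that [of n] unique by blast
    qed
    \<comment> \<open>Now \<open>theta_index k = n\<close>, so the four positions after
      \<open>k\<close> avoid the omitted index and the form uses variables from \<open>S\<close>
      only.\<close>
    define k where "k = int (n div 2)"
    have "theta_index (k + i) \<in> S" if "i \<in> {1..4}" for i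
    proof -
      have "i = 1 \<or> i = 2 \<or> i = 3 \<or> i = 4"
        using that by auto
      then have "theta_index (k + i) \<in> {1, 3, 5, 7, 9} - {n}"
        using n(1) by (auto simp: theta_index_def k_def)
      then show ?thesis
        using n(2) by blast
    qed
    then have "polynomial_fun S (theta_resolvent k)"
      by (rule polynomial_fun_theta_resolvent)
    moreover obtain x where "theta_resolvent k x \<noteq> 0"
      using theta_resolvent_nonzero by blast
    ultimately have "alg_dependent_on (\<lambda>k. theta_const (3/5) (real k / 5)) S upper_half_plane"
      using S theta_resolvent_eq_0
      by (intro alg_dependent_onI [where p = "theta_resolvent k"])
         (auto intro: finite_subset simp: upper_half_plane_def)
    with indep show False
      by (simp add: alg_independent_on_def)
  qed
qed

end
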